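(* Let $m,p$ be positive integers and let $a,b,x$ be real numbers with $|a|=|b|>1$ and $|x|<|a|^{-1}$ (equivalently $|x|<|b|^{-1}$). Then \begin{align*} &(-1)^p\sum_{n=1}^\infty \frac{H_n^{(1)}(ax)H_n^{(m)}(b)}{a^n n^p}-(-1)^m\sum_{n=1}^\infty \frac{H_n^{(1)}(bx)H_n^{(p)}(a)}{b^n n^m}\\ =&\sum_{i=1}^{p-1}(-1)^{i-1}\mathrm{Li}_{p+1-i}(ax)\sum_{n=1}^\infty \frac{H_n^{(m)}(b)}{n^i}x^n-\sum_{i=1}^{m-1}(-1)^{i-1}\mathrm{Li}_{m+1-i}(bx)\sum_{n=1}^\infty \frac{H_n^{(p)}(a)}{n^i}x^n\\ &+(-1)^p\ln(1-ax)\sum_{n=1}^\infty \frac{H_n^{(m)}(b)}{n^p}\left(x^n-a^{-n}\right)-(-1)^m\ln(1-bx)\sum_{n=1}^\infty \frac{H_n^{(p)}(a)}{n^m}\left(x^n-b^{-n}\right). \end{align*}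
   Context: For a positive integer $p$ and real $a$, $H_n^{(p)}(a):=\sum_{j=1}^n \frac{a^j}{j^p}$ (so $H_n^{(p)}(1)=H_n^{(p)}=\sum_{j=1}^n j^{-p}$). $\mathrm{Li}_p(x)=\sum_{n\ge1}x^n/n^p$ is the polylogarithm, with $\mathrm{Li}_1(x)=-\ln(1-x)$. *)

theory Defs
  imports "HOL-Analysis.Analysis"
begin

definition H :: "nat \<Rightarrow> real \<Rightarrow> nat \<Rightarrow> real" where
  "H p a n = (\<Sum>j=1..n. a ^ j / real j ^ p)"

text \<open>Series over \<open>n \<ge> 1\<close> are written as series over \<^typ>\<open>nat\<close> evaluated at \<^term>\<open>Suc n\<close>.\<close>

definition Li :: "nat \<Rightarrow> real \<Rightarrow> real" where
  "Li p x = (\<Sum>n. x ^ Suc n / real (Suc n) ^ p)"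

lemma Li_1:
  assumes "\<bar>x\<bar> < 1"
  shows "Li 1 x = - ln (1 - x)"
proof -
  have "(\<lambda>n. - (x ^ n / real n)) sums ln (1 - x)"
    using ln_series'[of "- x"] assms by simp
  then have "(\<lambda>n. x ^ n / real n) sums (- ln (1 - x))"
    using sums_minus by fastforce
  then have "(\<lambda>n. x ^ Suc n / real (Suc n)) sums (- ln (1 - x))"
    by (subst sums_Suc_iff) simp
  then show ?thesis
    unfolding Li_def by (simp add: sums_iff)
qed

end

theory Submission
  imports Defs
begin

text \<open>
  Let \<open>J\<^sub>p(n) = \<Sum>\<^bsub>k\<ge>1\<^esub> a\<^sup>k x\<^bsup>n+k\<^esup> / (k\<^sup>p (n + k))\<close>, which is the integral of
  \<open>t\<^bsup>n-1\<^esup> Li\<^sub>p(at)\<close> over \<open>[0, x]\<close>. The partial fraction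
  \<open>1 / (k\<^sup>p (n + k)) = (1 / k\<^sup>p - 1 / (k\<^bsup>p-1\<^esup> (n + k))) / n\<close> gives a recursion in \<open>p\<close> that ends at
  \<open>J\<^sub>0\<close>, a tail of the logarithm series; this evaluates \<open>J\<^sub>p(n)\<close> in closed form. Hence
  \<open>\<Sum>\<^sub>n H\<^sub>n\<^bsup>(m)\<^esup>(b) J\<^sub>p(n)\<close> is the contribution of \<open>(p, a)\<close> to the identity. On the other hand,
  the coefficient of \<open>x\<^sup>N / N\<close> in this double series is the sum of \<open>b\<^sup>j a\<^sup>k / (j\<^sup>m k\<^sup>p)\<close> over
  \<open>j + k \<le> N\<close>, which does not change when \<open>(m, b)\<close> and \<open>(p, a)\<close> are exchanged.
\<close>

section \<open>Rearranging double sums\<close>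

text \<open>The product bound makes \<open>f\<close> absolutely summable over all pairs, so the
  iterated sum by rows and the sum along antidiagonals are both the unordered sum over the
  plane.\<close>

lemma double_series_diagonal:
  fixes f :: "nat \<Rightarrow> nat \<Rightarrow> real"
  assumes bound: "\<And>n k. \<bar>f n k\<bar> \<le> u n * v k"
    and u: "summable u" "\<And>n. 0 \<le> u n" and v: "summable v" "\<And>k. 0 \<le> v k"
  shows "(\<Sum>n. \<Sum>k. f n k) = (\<Sum>N. \<Sum>i\<le>N. f i (N - i))"
proof -
  have uv: "(\<lambda>(n, k). u n * v k) summable_on UNIV \<times> UNIV"
    by (rule summable_on_SigmaI[where g = "\<lambda>n. u n * suminf v"])
      (use u v in \<open>auto intro!: has_sum_cmult_right summable_on_cmult_left sums_nonneg_imp_has_sum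
        summable_nonneg_imp_summable_on summable_sums\<close>)
  have f: "(\<lambda>(n, k). f n k) summable_on UNIV \<times> UNIV"
    by (rule abs_summable_summable, rule summable_on_comparison_test[OF uv])
      (use bound in auto)
  have row: "summable (\<lambda>k. f n k)" "summable (\<lambda>k. \<bar>f n k\<bar>)" for n
  proof -
    show "summable (\<lambda>k. \<bar>f n k\<bar>)"
      by (rule summable_comparison_test'[where g = "\<lambda>k. u n * v k" and N = 0])
        (use bound v in \<open>auto intro: summable_mult\<close>)
    then show "summable (\<lambda>k. f n k)"
      by (rule summable_rabs_cancel)
  qed
  have row_sum: "((\<lambda>k. f n k) has_sum (\<Sum>k. f n k)) UNIV" for n
    using row[of n] by (intro norm_summable_imp_has_sum summable_sums) auto
  have total: "((\<lambda>(n, k). f n k) has_sum infsum (\<lambda>(n, k). f n k) (UNIV \<times> UNIV)) (UNIV \<times> UNIV)"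
    using f by (rule has_sum_infsum)
  have "((\<lambda>n. \<Sum>k. f n k) has_sum infsum (\<lambda>(n, k). f n k) (UNIV \<times> UNIV)) UNIV"
    using has_sum_SigmaD[OF total] row_sum by simp
  then have 1: "(\<lambda>n. \<Sum>k. f n k) sums infsum (\<lambda>(n, k). f n k) (UNIV \<times> UNIV)"
    by (rule has_sum_imp_sums)
  \<comment> \<open>On the triangle \<open>i \<le> N\<close> the subtraction on naturals is exact,
    so \<open>(n + k, n)\<close> recovers \<open>(N, i)\<close>.\<close>
  have bij: "bij_betw (\<lambda>(N, i). (i, N - i)) (SIGMA N:UNIV. {..N}) (UNIV \<times> (UNIV :: nat set))"
    by (rule bij_betwI[where g = "\<lambda>(n, k). (n + k, n)"]) auto
  have "((\<lambda>(N, i). f i (N - i)) has_sum infsum (\<lambda>(n, k). f n k) (UNIV \<times> UNIV))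
      (SIGMA N:UNIV. {..N})"
    using total has_sum_reindex_bij_betw[OF bij, of "\<lambda>(n, k). f n k"]
    by (simp add: case_prod_unfold)
  from has_sum_SigmaD[OF this, of "\<lambda>N. \<Sum>i\<le>N. f i (N - i)"]
  have "((\<lambda>N. \<Sum>i\<le>N. f i (N - i)) has_sum infsum (\<lambda>(n, k). f n k) (UNIV \<times> UNIV)) UNIV"
    by (simp add: has_sum_finite)
  then have 2: "(\<lambda>N. \<Sum>i\<le>N. f i (N - i)) sums infsum (\<lambda>(n, k). f n k) (UNIV \<times> UNIV)"
    by (rule has_sum_imp_sums)
  from 1 2 show ?thesis
    by (simp add: sums_iff)
qed

text \<open>Both sides are the sum of \<open>u j * w k\<close> over all
  \<open>j + k \<le> N\<close>, a region symmetric in \<open>j\<close> and \<open>k\<close>.\<close>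

lemma sum_partial_sums_convolution_commute:
  fixes u w :: "nat \<Rightarrow> real"
  shows "(\<Sum>i\<le>N. (\<Sum>j\<le>i. u j) * w (N - i)) = (\<Sum>i\<le>N. (\<Sum>j\<le>i. w j) * u (N - i))"
proof -
  have rev: "(\<Sum>i\<le>N. g i) = (\<Sum>i\<le>N. g (N - i))" for g :: "nat \<Rightarrow> real"
    using sum.atLeastAtMost_rev[of g 0 N] by (simp add: atMost_atLeast0)
  have "(\<Sum>i\<le>N. (\<Sum>j\<le>i. u j) * w (N - i)) = (\<Sum>i\<le>N. \<Sum>j\<le>N - i. u j * w i)"
    by (subst rev) (simp add: sum_distrib_right)
  also have "\<dots> = (\<Sum>j\<le>N. \<Sum>i\<le>N - j. u j * w i)"
    by (simp add: sum.Sigma) (rule sum.reindex_bij_witness[of _ prod.swap prod.swap]; auto)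
  also have "\<dots> = (\<Sum>i\<le>N. (\<Sum>j\<le>i. w j) * u (N - i))"
    by (subst (2) rev)
      (simp add: sum_distrib_left mult.commute)
  finally show ?thesis .
qed

section \<open>Bounds and summability for harmonic sums\<close>

lemma H_Suc_eq: "H p a (Suc n) = (\<Sum>j\<le>n. a ^ Suc j / real (Suc j) ^ p)"
  unfolding H_def by (simp only: One_nat_def sum.atLeast1_atMost_eq lessThan_Suc_atMost)

lemma abs_H_le:
  assumes "m \<ge> 1"
  shows "\<bar>H m b n\<bar> \<le> H 1 \<bar>b\<bar> n"
  unfolding H_def
proof (rule order_trans[OF sum_abs], rule sum_mono)
  fix j assume "j \<in> {1..n}"
  then have "real j \<le> real j ^ m"
    using assms self_le_power[of "real j" m] by simp
  with \<open>j \<in> {1..n}\<close> show "\<bar>b ^ j / real j ^ m\<bar> \<le> \<bar>b\<bar> ^ j / real j ^ 1"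
    by (simp add: abs_divide power_abs frac_le)
qed

lemma H_nonneg: "0 \<le> a \<Longrightarrow> 0 \<le> H p a n"
  unfolding H_def by (intro sum_nonneg) auto

text \<open>There is no geometric decay to use here, since \<open>r ^ n\<close> only offsets the
  growth of \<open>H 1 r n\<close>. Instead the quotient is written as a convolution with powers of
  \<open>1 / r\<close>; weakening one factor \<open>n + 1\<close> to \<open>j + 1\<close> leaves the
  Cauchy product of the series of inverse squares with a geometric series.\<close>

lemma summable_H_over_power:
  assumes "r > 1"
  shows "summable (\<lambda>n. H 1 r (Suc n) / (real (Suc n) * r ^ Suc n))"
proof -
  have sq: "summable (\<lambda>j. norm (1 / real (Suc j) ^ 2))"
    using summable_Suc_iff[of "\<lambda>j. inverse (real j ^ 2)"] inverse_power_summable[of 2, where 'a = real]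
    by (simp add: inverse_eq_divide)
  have geo: "summable (\<lambda>j. norm (inverse r ^ j))"
    using assms by (simp add: summable_geometric inverse_less_1_iff)
  show ?thesis
  proof (rule summable_comparison_test'[OF summable_Cauchy_product[OF sq geo], of 0])
    fix n
    have "H 1 r (Suc n) / (real (Suc n) * r ^ Suc n)
        = (\<Sum>j\<le>n. 1 / (real (Suc j) * real (Suc n)) * inverse r ^ (n - j))"
      unfolding H_Suc_eq sum_divide_distrib using assms
      by (intro sum.cong) (auto simp: power_diff field_simps simp del: of_nat_Suc)
    also have "\<dots> \<le> (\<Sum>j\<le>n. 1 / real (Suc j) ^ 2 * inverse r ^ (n - j))"
      using assms
      by (intro sum_mono mult_right_mono frac_le) (auto simp: power2_eq_square)
    finally show "norm (H 1 r (Suc n) / (real (Suc n) * r ^ Suc n))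
        \<le> (\<Sum>j\<le>n. 1 / real (Suc j) ^ 2 * inverse r ^ (n - j))"
      using assms H_nonneg[of r 1 "Suc n"] by simp
  qed
qed

context
  fixes b r y :: real and m p :: nat
  assumes r: "r = \<bar>b\<bar>" "r > 1" and y: "\<bar>y\<bar> \<le> inverse r" and mp: "m \<ge> 1" "p \<ge> 1"
begin

text \<open>One majorant serves all \<open>m\<close>, \<open>p\<close> and \<open>y\<close>. The
  bound on \<open>y\<close> is not strict because the identity uses both \<open>y = x\<close> and
  the boundary point \<open>y = inverse a\<close>.\<close>

lemma abs_H_div_power_le:
  "\<bar>H m b (Suc n) / real (Suc n) ^ p * y ^ Suc n\<bar> \<le> H 1 r (Suc n) / (real (Suc n) * r ^ Suc n)"
proof -
  have "real (Suc n) \<le> real (Suc n) ^ p"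
    using mp by (intro self_le_power) auto
  then have "\<bar>H m b (Suc n)\<bar> / real (Suc n) ^ p \<le> H 1 r (Suc n) / real (Suc n)"
    using abs_H_le[OF mp(1), of b "Suc n"] r by (intro frac_le) auto
  moreover have "\<bar>y\<bar> ^ Suc n \<le> inverse r ^ Suc n"
    using y by (intro power_mono) auto
  ultimately have "\<bar>H m b (Suc n)\<bar> / real (Suc n) ^ p * \<bar>y\<bar> ^ Suc n
      \<le> H 1 r (Suc n) / real (Suc n) * inverse r ^ Suc n"
    using H_nonneg[of r 1 "Suc n"] r by (intro mult_mono) auto
  then show ?thesis
    by (simp add: abs_mult power_abs power_inverse divide_inverse mult.assoc del: of_nat_Suc power_Suc)
qed

lemma summable_H_div_power: "summable (\<lambda>n. H m b (Suc n) / real (Suc n) ^ p * y ^ Suc n)"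
  by (rule summable_comparison_test'[OF summable_H_over_power[OF r(2)], of 0])
    (simp only: real_norm_def abs_H_div_power_le)

end

section \<open>Polylogarithms and the closed form of \<open>J\<close>\<close>

lemma Li_summable: "\<bar>z\<bar> < 1 \<Longrightarrow> summable (\<lambda>k. z ^ Suc k / real (Suc k) ^ p)"
proof (rule summable_comparison_test'[where g = "\<lambda>k. \<bar>z\<bar> ^ Suc k" and N = 0])
  show "\<bar>z\<bar> < 1 \<Longrightarrow> summable (\<lambda>k. \<bar>z\<bar> ^ Suc k)"
    by (simp only: summable_Suc_iff) (simp add: summable_geometric)
  show "norm (z ^ Suc n / real (Suc n) ^ p) \<le> \<bar>z\<bar> ^ Suc n" for n
    using frac_le[of "\<bar>z\<bar> ^ Suc n" "\<bar>z\<bar> ^ Suc n" 1 "real (Suc n) ^ p"] one_le_power[of "real (Suc n)" p]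
    by (simp add: power_abs abs_mult del: of_nat_Suc)
qed

definition J :: "nat \<Rightarrow> real \<Rightarrow> real \<Rightarrow> nat \<Rightarrow> real" where
  "J p a x n = (\<Sum>k. a ^ Suc k * x ^ (n + Suc k) / (real (Suc k) ^ p * real (n + Suc k)))"

lemma J_summable:
  assumes "\<bar>a * x\<bar> < 1"
  shows "summable (\<lambda>k. a ^ Suc k * x ^ (n + Suc k) / (real (Suc k) ^ p * real (n + Suc k)))"
proof -
  have "norm (a ^ Suc k * x ^ (n + Suc k) / (real (Suc k) ^ p * real (n + Suc k)))
      \<le> \<bar>x\<bar> ^ n * (\<bar>a * x\<bar> ^ Suc k / real (Suc k) ^ p)" for k
  proof -
    have "norm (a ^ Suc k * x ^ (n + Suc k) / (real (Suc k) ^ p * real (n + Suc k)))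
        = \<bar>x\<bar> ^ n * (\<bar>a * x\<bar> ^ Suc k / real (Suc k) ^ p) * (1 / real (n + Suc k))"
      by (simp add: abs_mult power_abs power_add power_mult_distrib
          del: of_nat_Suc power_Suc add_Suc_right)
    also have "\<dots> \<le> \<bar>x\<bar> ^ n * (\<bar>a * x\<bar> ^ Suc k / real (Suc k) ^ p) * 1"
      by (intro mult_left_mono) auto
    finally show ?thesis by simp
  qed
  then show ?thesis
    using assms
    by (intro summable_comparison_test'[OF summable_mult[OF Li_summable[of "\<bar>a * x\<bar>" p]]])
      (simp only: abs_idempotent)
qed

text \<open>The summand is \<open>a ^ (- n)\<close> times the term of index \<open>n + k + 1\<close>
  in the series of \<open>- ln (1 - a * x)\<close>; the missing first \<open>n\<close> terms are
  what brings \<open>H 1 (a * x) n\<close> into the identity.\<close>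

lemma J_0:
  assumes "\<bar>a * x\<bar> < 1" "a \<noteq> 0"
  shows "J 0 a x n = - (ln (1 - a * x) + H 1 (a * x) n) / a ^ n"
proof -
  let ?g = "\<lambda>k. (a * x) ^ Suc k / real (Suc k)"
  have "suminf ?g = (\<Sum>k. ?g (k + n)) + sum ?g {..<n}"
    using Li_summable[OF assms(1), of 1] by (intro suminf_split_initial_segment) simp
  moreover have "suminf ?g = - ln (1 - a * x)"
    using Li_1[OF assms(1)] by (simp add: Li_def)
  moreover have "sum ?g {..<n} = H 1 (a * x) n"
    unfolding H_def by (simp only: One_nat_def sum.atLeast1_atMost_eq) simp
  ultimately have "(\<Sum>k. ?g (k + n)) = - (ln (1 - a * x) + H 1 (a * x) n)"
    by simp
  moreover have "J 0 a x n = (\<Sum>k. ?g (k + n) / a ^ n)"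
    unfolding J_def
  proof (rule suminf_cong)
    fix k
    have "(a * x) ^ Suc (k + n) = a ^ n * (a ^ Suc k * x ^ (n + Suc k))"
      by (simp add: power_add power_mult_distrib mult_ac)
    then show "a ^ Suc k * x ^ (n + Suc k) / (real (Suc k) ^ 0 * real (n + Suc k)) = ?g (k + n) / a ^ n"
      using assms(2) by (simp add: add.commute del: power_Suc of_nat_Suc)
  qed
  moreover have "\<dots> = (\<Sum>k. ?g (k + n)) / a ^ n"
    using Li_summable[OF assms(1), of 1]
    by (intro suminf_divide) (simp only: summable_iff_shift[of ?g] power_one_right)
  ultimately show ?thesis by simp
qed

lemma J_Suc:
  assumes "\<bar>a * x\<bar> < 1" "n > 0"
  shows "J (Suc p) a x n = x ^ n / real n * Li (Suc p) (a * x) - J p a x n / real n"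
proof -
  have "J (Suc p) a x n
      = (\<Sum>k. x ^ n / real n * ((a * x) ^ Suc k / real (Suc k) ^ Suc p)
          - a ^ Suc k * x ^ (n + Suc k) / (real (Suc k) ^ p * real (n + Suc k)) / real n)"
    unfolding J_def
  proof (rule suminf_cong)
    fix k
    have frac: "1 / (K ^ Suc p * (N + K)) = (1 / K ^ Suc p - 1 / (K ^ p * (N + K))) / N"
      if "K > 0" "N > 0" for K N :: real
    proof -
      have "N + K \<noteq> 0" using that by linarith
      with that show ?thesis by (simp add: divide_simps)
    qed
    have "a ^ Suc k * x ^ (n + Suc k) / (real (Suc k) ^ Suc p * real (n + Suc k))
        = x ^ n * (a * x) ^ Suc k * (1 / (real (Suc k) ^ Suc p * (real n + real (Suc k))))"
      by (simp add: power_add power_mult_distrib mult_ac del: of_nat_Suc power_Suc add_Suc_right)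
    also have "\<dots> = x ^ n / real n * ((a * x) ^ Suc k / real (Suc k) ^ Suc p)
        - x ^ n * (a * x) ^ Suc k / (real (Suc k) ^ p * (real n + real (Suc k))) / real n"
      by (subst frac) (use assms in \<open>simp_all add: diff_divide_distrib right_diff_distrib
        del: of_nat_Suc power_Suc\<close>)
    finally show "a ^ Suc k * x ^ (n + Suc k) / (real (Suc k) ^ Suc p * real (n + Suc k))
        = x ^ n / real n * ((a * x) ^ Suc k / real (Suc k) ^ Suc p)
          - a ^ Suc k * x ^ (n + Suc k) / (real (Suc k) ^ p * real (n + Suc k)) / real n"
      by (simp add: power_add power_mult_distrib mult_ac del: of_nat_Suc power_Suc add_Suc_right)
  qed
  also have "\<dots> = (\<Sum>k. x ^ n / real n * ((a * x) ^ Suc k / real (Suc k) ^ Suc p))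
      - (\<Sum>k. a ^ Suc k * x ^ (n + Suc k) / (real (Suc k) ^ p * real (n + Suc k)) / real n)"
    by (intro suminf_diff[symmetric] summable_mult summable_divide Li_summable J_summable assms)
  also have "\<dots> = x ^ n / real n * Li (Suc p) (a * x) - J p a x n / real n"
    unfolding Li_def J_def
    by (intro arg_cong2[where f = "(-)"] suminf_mult suminf_divide Li_summable J_summable assms)
  finally show ?thesis .
qed

text \<open>Each use of \<open>J_Suc\<close> splits off one polylogarithm and multiplies what
  remains by \<open>- 1 / n\<close>.\<close>

lemma J_eq_sum_Li:
  assumes "\<bar>a * x\<bar> < 1" "n > 0"
  shows "J p a x n = (\<Sum>i=1..p. (- 1) ^ (i - 1) * Li (p + 1 - i) (a * x) * x ^ n / real n ^ i)
    + (- 1) ^ p * J 0 a x n / real n ^ p"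
proof (induction p)
  case (Suc p)
  have "(\<Sum>i=1..Suc p. (- 1) ^ (i - 1) * Li (Suc p + 1 - i) (a * x) * x ^ n / real n ^ i)
      = x ^ n / real n * Li (Suc p) (a * x)
        + (\<Sum>i=1..p. (- 1) ^ i * Li (p + 1 - i) (a * x) * x ^ n / real n ^ Suc i)"
    \<comment> \<open>The term \<open>i = 1\<close> is split off and the index of the others drops
      by one, so the sign exponent \<open>i - 1\<close> turns into \<open>i\<close>.\<close>
    by (simp only: One_nat_def sum.atLeast1_atMost_eq sum.lessThan_Suc_shift) simp
  also have "(\<Sum>i=1..p. (- 1) ^ i * Li (p + 1 - i) (a * x) * x ^ n / real n ^ Suc i)
      = - (\<Sum>i=1..p. (- 1) ^ (i - 1) * Li (p + 1 - i) (a * x) * x ^ n / real n ^ i) / real n"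
    unfolding sum_divide_distrib sum_negf[symmetric]
  proof (rule sum.cong)
    fix i assume "i \<in> {1..p}"
    then obtain l where "i = Suc l" by (cases i) auto
    then show "(- 1) ^ i * Li (p + 1 - i) (a * x) * x ^ n / real n ^ Suc i
      = - ((- 1) ^ (i - 1) * Li (p + 1 - i) (a * x) * x ^ n / real n ^ i) / real n"
      by (simp add: mult_ac)
  qed simp
  finally show ?case
    unfolding J_Suc[OF assms] using assms(2) by (simp add: Suc.IH add_divide_distrib mult_ac)
qed simp

text \<open>The last term \<open>i = p\<close> contains
  \<open>Li 1 (a * x) = - ln (1 - a * x)\<close>; it merges with the logarithm from
  \<open>J 0\<close> into the factor \<open>x ^ n - inverse (a ^ n)\<close>.\<close>

lemma J_closed_form:
  assumes "\<bar>a * x\<bar> < 1" "a \<noteq> 0" "n > 0" "p \<ge> 1"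
  shows "J p a x n = (\<Sum>i=1..p-1. (- 1) ^ (i - 1) * Li (p + 1 - i) (a * x) * x ^ n / real n ^ i)
    + (- 1) ^ p * ln (1 - a * x) * ((x ^ n - inverse (a ^ n)) / real n ^ p)
    - (- 1) ^ p * (H 1 (a * x) n / (a ^ n * real n ^ p))"
proof -
  let ?F = "\<lambda>i. (- 1) ^ (i - 1) * Li (p + 1 - i) (a * x) * x ^ n / real n ^ i"
  obtain q where p: "p = Suc q" using assms(4) by (cases p) auto
  have "(\<Sum>i=1..p. ?F i) = (\<Sum>i=1..p-1. ?F i) + ?F p"
    by (simp add: p)
  moreover have "?F p = (- 1) ^ p * ln (1 - a * x) * x ^ n / real n ^ p"
    using Li_1[OF assms(1)] by (simp add: p)
  moreover have "(- 1) ^ p * J 0 a x n / real n ^ p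
      = - ((- 1) ^ p * ln (1 - a * x) * inverse (a ^ n) / real n ^ p)
        - (- 1) ^ p * (H 1 (a * x) n / (a ^ n * real n ^ p))"
    unfolding J_0[OF assms(1,2)] by (simp add: divide_inverse algebra_simps)
  moreover have "(- 1) ^ p * ln (1 - a * x) * ((x ^ n - inverse (a ^ n)) / real n ^ p)
      = (- 1) ^ p * ln (1 - a * x) * x ^ n / real n ^ p
        - (- 1) ^ p * ln (1 - a * x) * inverse (a ^ n) / real n ^ p"
    by (simp add: diff_divide_distrib right_diff_distrib)
  ultimately show ?thesis
    using J_eq_sum_Li[OF assms(1,3), of p] by linarith
qed

section \<open>Two evaluations of the series over \<open>H\<close> times \<open>J\<close>\<close>

lemma suminf_H_J:
  assumes "m \<ge> 1" "p \<ge> 1" "\<bar>a\<bar> = \<bar>b\<bar>" "\<bar>b\<bar> > 1" "\<bar>x\<bar> < inverse \<bar>a\<bar>"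
  shows "(\<Sum>n. H m b (Suc n) * J p a x (Suc n))
    = (\<Sum>i=1..p-1. (- 1) ^ (i - 1) * Li (p + 1 - i) (a * x)
         * (\<Sum>n. H m b (Suc n) / real (Suc n) ^ i * x ^ Suc n))
      + (- 1) ^ p * ln (1 - a * x)
         * (\<Sum>n. H m b (Suc n) / real (Suc n) ^ p * (x ^ Suc n - inverse (a ^ Suc n)))
      - (- 1) ^ p * (\<Sum>n. H 1 (a * x) (Suc n) * H m b (Suc n) / (a ^ Suc n * real (Suc n) ^ p))"
proof -
  have ax: "\<bar>a * x\<bar> < 1"
    using assms mult_strict_left_mono[of "\<bar>x\<bar>" "inverse \<bar>a\<bar>" "\<bar>a\<bar>"] by (simp add: abs_mult)
  have a0: "a \<noteq> 0" using assms by auto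
  note H_sm = summable_H_div_power[OF refl assms(4)]
  let ?U = "\<lambda>i n. H m b (Suc n) / real (Suc n) ^ i * x ^ Suc n"
  let ?V = "\<lambda>n. H m b (Suc n) / real (Suc n) ^ p * inverse a ^ Suc n"
  let ?W = "\<lambda>n. H m b (Suc n) / real (Suc n) ^ p * (x ^ Suc n - inverse (a ^ Suc n))"
  let ?Z = "\<lambda>n. H 1 (a * x) (Suc n) * H m b (Suc n) / (a ^ Suc n * real (Suc n) ^ p)"
  have U: "summable (?U i)" if "i \<ge> 1" for i
    using assms that by (intro H_sm) auto
  have "summable ?V"
    using assms by (intro H_sm) auto
  then have W: "summable ?W"
    using summable_diff[OF U[OF assms(2)] \<open>summable ?V\<close>]
    by (simp add: right_diff_distrib power_inverse del: power_Suc of_nat_Suc)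
  \<comment> \<open>Absolute convergence is what survives multiplication by the bounded factor
    \<open>H 1 (a * x)\<close> in \<open>?Z\<close>.\<close>
  have V_abs: "summable (\<lambda>n. \<bar>?V n\<bar>)"
    using assms
    by (intro summable_comparison_test'[OF summable_H_over_power[OF assms(4)], of 0])
      (simp only: real_norm_def abs_abs, intro abs_H_div_power_le, auto)
  have Z: "summable ?Z"
  proof -
    have "?Z n = H 1 (a * x) (Suc n) * ?V n" for n
      by (simp add: divide_inverse power_inverse mult_ac del: of_nat_Suc power_Suc)
    \<comment> \<open>These are the partial sums of the convergent series
      \<open>Li 1 (a * x)\<close>.\<close>
    moreover have "\<exists>B. \<forall>n. \<bar>H 1 (a * x) (Suc n)\<bar> \<le> B"
    proof -
      have "(\<lambda>n. \<Sum>j\<le>n. (a * x) ^ Suc j / real (Suc j) ^ 1) \<longlonglongrightarrow> Li 1 (a * x)"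
        unfolding Li_def by (rule summable_LIMSEQ'[OF Li_summable[OF ax]])
      then have "Bseq (\<lambda>n. H 1 (a * x) (Suc n))"
        unfolding H_Suc_eq by (intro convergent_imp_Bseq convergentI)
      then show ?thesis by (auto simp: Bseq_def)
    qed
    then obtain B where B: "\<And>n. \<bar>H 1 (a * x) (Suc n)\<bar> \<le> B" by blast
    have "summable (\<lambda>n. H 1 (a * x) (Suc n) * ?V n)"
      by (rule summable_comparison_test'[OF summable_mult[OF V_abs, of B], of 0])
        (simp only: real_norm_def abs_mult, intro mult_right_mono B, auto)
    ultimately show ?thesis by simp
  qed
  let ?c = "\<lambda>i. (- 1) ^ (i - 1) * Li (p + 1 - i) (a * x)"
  have "H m b (Suc n) * J p a x (Suc n)
      = (\<Sum>i=1..p-1. ?c i * ?U i n) + (- 1) ^ p * ln (1 - a * x) * ?W n - (- 1) ^ p * ?Z n" for n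
    unfolding J_closed_form[OF ax a0 zero_less_Suc assms(2)]
    by (simp add: distrib_left right_diff_distrib sum_distrib_left mult_ac
        del: of_nat_Suc power_Suc)
  moreover have "(\<lambda>n. (\<Sum>i=1..p-1. ?c i * ?U i n) + (- 1) ^ p * ln (1 - a * x) * ?W n
        - (- 1) ^ p * ?Z n)
      sums ((\<Sum>i=1..p-1. ?c i * suminf (?U i)) + (- 1) ^ p * ln (1 - a * x) * suminf ?W
        - (- 1) ^ p * suminf ?Z)"
    by (intro sums_add sums_diff sums_sum sums_mult summable_sums U W Z) auto
  ultimately show ?thesis
    by (simp only: sums_iff)
qed

text \<open>After expanding \<open>J\<close>, the factor
  \<open>x ^ (n + k + 2) / (n + k + 2)\<close> is constant on each antidiagonal
  \<open>n + k = N\<close> and can be pulled out. The 2 collects the index shifts of the two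
  series.\<close>

lemma suminf_H_J_diagonal:
  assumes "m \<ge> 1" "p \<ge> 1" "\<bar>a\<bar> = \<bar>b\<bar>" "\<bar>b\<bar> > 1" "\<bar>x\<bar> < inverse \<bar>a\<bar>"
  shows "(\<Sum>n. H m b (Suc n) * J p a x (Suc n))
    = (\<Sum>N. (\<Sum>i\<le>N. H m b (Suc i) * (a ^ Suc (N - i) / real (Suc (N - i)) ^ p))
        * (x ^ (N + 2) / real (N + 2)))"
proof -
  have ax: "\<bar>a * x\<bar> < 1"
    using assms mult_strict_left_mono[of "\<bar>x\<bar>" "inverse \<bar>a\<bar>" "\<bar>a\<bar>"] by (simp add: abs_mult)
  define f where "f n k = H m b (Suc n) * (a ^ Suc k / real (Suc k) ^ p)
    * (x ^ (n + k + 2) / real (n + k + 2))" for n k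
  let ?g = "\<lambda>n. H 1 \<bar>b\<bar> (Suc n) / (real (Suc n) * \<bar>b\<bar> ^ Suc n)"
  have bound: "\<bar>f n k\<bar> \<le> ?g n * \<bar>a * x\<bar> ^ Suc k" for n k
  proof -
    \<comment> \<open>Only \<open>n + 1\<close> is kept of the denominator: it makes the majorant in
      \<open>n\<close> summable, while the geometric factor in \<open>a * x\<close> handles
      \<open>k\<close>.\<close>
    have "real (Suc n) \<le> real (Suc k) ^ p * real (n + k + 2)"
      using mult_mono[of 1 "real (Suc k) ^ p" "real (Suc n)" "real (n + k + 2)"] by simp
    then have "\<bar>f n k\<bar> \<le> \<bar>H m b (Suc n)\<bar> * (\<bar>a\<bar> ^ Suc k * \<bar>x\<bar> ^ (n + k + 2)) / real (Suc n)"
      unfolding f_def abs_mult abs_divide power_abs[symmetric]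
      by (simp add: frac_le power_abs abs_mult mult.assoc del: power_Suc of_nat_Suc)
    also have "\<dots> = \<bar>H m b (Suc n) / real (Suc n) ^ 1 * x ^ Suc n\<bar> * \<bar>a * x\<bar> ^ Suc k"
      by (simp add: abs_mult power_abs power_add power_mult_distrib mult_ac power2_eq_square)
    also have "\<dots> \<le> ?g n * \<bar>a * x\<bar> ^ Suc k"
      using assms by (intro mult_right_mono abs_H_div_power_le) auto
    finally show ?thesis .
  qed
  have geo: "summable (\<lambda>k. \<bar>a * x\<bar> ^ Suc k)"
    using ax by (simp only: summable_Suc_iff) (simp add: summable_geometric)
  have "(\<Sum>n. \<Sum>k. f n k) = (\<Sum>N. \<Sum>i\<le>N. f i (N - i))"
    by (rule double_series_diagonal[OF bound summable_H_over_power[OF assms(4)] _ geo])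
      (auto intro!: divide_nonneg_nonneg H_nonneg)
  moreover have "(\<Sum>k. f n k) = H m b (Suc n) * J p a x (Suc n)" for n
    unfolding J_def
    by (subst suminf_mult[OF J_summable[OF ax], symmetric])
      (auto intro!: suminf_cong simp: f_def mult_ac)
  moreover have "(\<Sum>i\<le>N. f i (N - i))
      = (\<Sum>i\<le>N. H m b (Suc i) * (a ^ Suc (N - i) / real (Suc (N - i)) ^ p))
        * (x ^ (N + 2) / real (N + 2))" for N
    unfolding sum_distrib_right f_def by (intro sum.cong) auto
  ultimately show ?thesis by simp
qed

theorem theorem3p8:
  fixes m p :: nat and a b x :: real
  assumes "m \<ge> 1" and "p \<ge> 1"
    and "\<bar>a\<bar> = \<bar>b\<bar>" and "\<bar>b\<bar> > 1"
    and "\<bar>x\<bar> < inverse \<bar>a\<bar>"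
  shows
    "(- 1) ^ p * (\<Sum>n. H 1 (a * x) (Suc n) * H m b (Suc n) / (a ^ Suc n * real (Suc n) ^ p))
     - (- 1) ^ m * (\<Sum>n. H 1 (b * x) (Suc n) * H p a (Suc n) / (b ^ Suc n * real (Suc n) ^ m))
     = (\<Sum>i=1..p-1. (- 1) ^ (i - 1) * Li (p + 1 - i) (a * x)
           * (\<Sum>n. H m b (Suc n) / real (Suc n) ^ i * x ^ Suc n))
       - (\<Sum>i=1..m-1. (- 1) ^ (i - 1) * Li (m + 1 - i) (b * x)
           * (\<Sum>n. H p a (Suc n) / real (Suc n) ^ i * x ^ Suc n))
       + (- 1) ^ p * ln (1 - a * x)
           * (\<Sum>n. H m b (Suc n) / real (Suc n) ^ p * (x ^ Suc n - inverse (a ^ Suc n)))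
       - (- 1) ^ m * ln (1 - b * x)
           * (\<Sum>n. H p a (Suc n) / real (Suc n) ^ m * (x ^ Suc n - inverse (b ^ Suc n)))"
proof -
  \<comment> \<open>Since \<open>H\<close> consists of partial sums, the diagonal coefficients for
    \<open>(m, b)\<close> and \<open>(p, a)\<close> agree by the commutation lemma.\<close>
  have "(\<Sum>n. H m b (Suc n) * J p a x (Suc n)) = (\<Sum>n. H p a (Suc n) * J m b x (Suc n))"
    using suminf_H_J_diagonal[of m p a b x] suminf_H_J_diagonal[of p m b a x] assms
      sum_partial_sums_convolution_commute[of "\<lambda>j. b ^ Suc j / real (Suc j) ^ m"
        "\<lambda>j. a ^ Suc j / real (Suc j) ^ p"]
    unfolding H_Suc_eq by simp
  \<comment> \<open>Equating the two closed forms and moving the series with \<open>H 1\<close> to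
    one side gives the identity.\<close>
  then show ?thesis
    using suminf_H_J[of m p a b x] suminf_H_J[of p m b a x] assms by simp
qed

end
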